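(* Let $b\in(0,+\infty)$, $r>0$ and $x_R\in(0,b)$ be fixed, and let $\mathcal X(t)$ be the diffusion process with stochastic resetting (resetting rate $r$, reset position $x_R$) obtained from the diffusion $dX(t)=\mu(X(t))\,dt+\sigma(X(t))\,dW_t$, with random initial position $\mathcal X(0)=\eta\in(0,b)$ independent of $\mathcal X(t)$ (as described in the context). Let $\tau_{0,b}=\inf\{t\ge 0:\mathcal X(t)\notin(0,b)\}$ and let $q\in(0,1)$. If a probability density $g$ on $(0,b)$ is a solution to the inverse first-passage place problem for $q$, i.e. if, when $\eta$ has density $g$, one has $P(\mathcal X(\tau_{0,b})=0)=q$, then $g$ must satisfy $$q=\int_0^b g(x)\,\pi_0(x)\,dx ,$$ where $\pi_0$ is the solution $f=\pi_0$ of the problem $$\begin{cases}\frac12\sigma^2(x)f''(x)+\mu(x)f'(x)+r\,(f(x_R)-f(x))=0,\quad x\in(0,b),\\ f(0)=1,\quad f(b)=0.\end{cases}$$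
   Context: Underlying diffusion: $X(t)$ is the one-dimensional time-homogeneous diffusion driven by $dX(t)=\mu(X(t))\,dt+\sigma(X(t))\,dW_t$, $X(0)=\eta$, where $W_t$ is a standard Brownian motion and the coefficients $\mu(\cdot),\sigma(\cdot)$ are regular enough functions that the SDE has a unique strong solution. Diffusion with resetting: resetting events occur according to a homogeneous Poisson process of rate $r>0$. Until the first resetting event, $\mathcal X(t)$ coincides with $X(t)$, with $\mathcal X(0)=X(0)=\eta$. At a resetting event $\mathcal X(t)$ is set instantly to the position $x_R$, after which it evolves again according to the same SDE, starting afresh from $x_R$ independently of the past history, until the next resetting event, and so on. Inter-resetting times are i.i.d. exponential with parameter $r$. "The initial position $\eta$ is independent of $\mathcal X(t)$" means that $\eta$ is independent of the driving randomness (Brownian motion and Poisson resetting process). Notation and standing assumptions: for $x\in(0,b)$, let $\tau_{0,b}(x)$ be the first-exit time of $\mathcal X(t)$ from $(0,b)$ under the condition $\mathcal X(0)=x$. It is assumed that $\tau_{0,b}(x)$ is finite with probability one, and that $\mathcal X$ exits $(0,b)$ at $0$ or at $b$. It is taken as known that the function $x\mapsto P(\mathcal X(\tau_{0,b}(x))=0)$, the probability of first exit from the left end when the process starts at $x$, satisfies the boundary value problem displayed in the claim; $\pi_0(x)$ denotes this function, referred to as the solution of that problem. *)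

theory Defs
  imports "HOL-Probability.Probability"
begin

section \<open>Stochastic bases, Brownian motion and the Ito integral\<close>

text \<open>
  Time is the half-line of reals \<open>t \<ge> 0\<close>; a process is a function of time and sample point, and
  its values at negative times are irrelevant.  Spaces and filtrations are complete;
  right-continuity of filtrations is not needed.
\<close>

definition stochastic_basis :: "'a measure \<Rightarrow> (real \<Rightarrow> 'a measure) \<Rightarrow> bool" where
  "stochastic_basis M F \<longleftrightarrow>
     prob_space M \<and> complete_measure M \<and> filtration (space M) F \<and>
     (\<forall>t. subalgebra M (F t) \<and> null_sets M \<subseteq> sets (F t))"

text \<open>
  The library's \<open>indep_var\<close> forces both variables to have the same type; this is what it unfolds to,
  for two variables of possibly different types.
\<close>

definition indep_rv :: "'a measure \<Rightarrow> 'b measure \<Rightarrow> ('a \<Rightarrow> 'b) \<Rightarrow> 'c measure \<Rightarrow> ('a \<Rightarrow> 'c) \<Rightarrow> bool" where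
  "indep_rv M N X K Y \<longleftrightarrow>
     X \<in> measurable M N \<and> Y \<in> measurable M K \<and>
     prob_space.indep_set M {X -` A \<inter> space M | A. A \<in> sets N} {Y -` A \<inter> space M | A. A \<in> sets K}"

definition continuous_paths :: "'a measure \<Rightarrow> (real \<Rightarrow> 'a \<Rightarrow> real) \<Rightarrow> bool" where
  "continuous_paths M X \<longleftrightarrow> (AE \<omega> in M. continuous_on {0..} (\<lambda>t. X t \<omega>))"

definition adapted :: "(real \<Rightarrow> 'a measure) \<Rightarrow> (real \<Rightarrow> 'a \<Rightarrow> real) \<Rightarrow> bool" where
  "adapted F X \<longleftrightarrow> (\<forall>t\<ge>0. X t \<in> borel_measurable (F t))"

definition brownian_motion :: "'a measure \<Rightarrow> (real \<Rightarrow> 'a measure) \<Rightarrow> (real \<Rightarrow> 'a \<Rightarrow> real) \<Rightarrow> bool" where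
  "brownian_motion M F B \<longleftrightarrow>
     adapted F B \<and> continuous_paths M B \<and> (AE \<omega> in M. B 0 \<omega> = 0) \<and>
     (\<forall>s t. 0 \<le> s \<and> s < t \<longrightarrow>
        distributed M lborel (\<lambda>\<omega>. B t \<omega> - B s \<omega>) (\<lambda>x. ennreal (normal_density 0 (sqrt (t - s)) x)) \<and>
        prob_space.indep_set M (sets (F s))
          {(\<lambda>\<omega>. B t \<omega> - B s \<omega>) -` A \<inter> space M | A. A \<in> sets borel})"

definition tendsto_zero_in_prob :: "'a measure \<Rightarrow> (nat \<Rightarrow> 'a \<Rightarrow> ennreal) \<Rightarrow> bool" where
  "tendsto_zero_in_prob M Z \<longleftrightarrow>
     (\<forall>n. Z n \<in> borel_measurable M) \<and>
     (\<forall>e>0. (\<lambda>n. measure M {\<omega> \<in> space M. ennreal e < Z n \<omega>}) \<longlonglongrightarrow> 0)"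

text \<open>
  A simple process with \<open>k\<close> steps has the value \<open>\<xi> i\<close>, which is known at time \<open>p i\<close>, on the interval
  from \<open>p i\<close> (excluded) to \<open>p (Suc i)\<close> (included).
\<close>

definition simple_data ::
    "'a measure \<Rightarrow> (real \<Rightarrow> 'a measure) \<Rightarrow> nat \<Rightarrow> (nat \<Rightarrow> real) \<Rightarrow> (nat \<Rightarrow> 'a \<Rightarrow> real) \<Rightarrow> bool" where
  "simple_data M F k p \<xi> \<longleftrightarrow>
     0 \<le> p 0 \<and>
     (\<forall>i<k. p i \<le> p (Suc i) \<and> \<xi> i \<in> borel_measurable (F (p i)) \<and> bounded (\<xi> i ` space M))"

definition simple_process ::
    "nat \<Rightarrow> (nat \<Rightarrow> real) \<Rightarrow> (nat \<Rightarrow> 'a \<Rightarrow> real) \<Rightarrow> real \<Rightarrow> 'a \<Rightarrow> real" where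
  "simple_process k p \<xi> t \<omega> = (\<Sum>i<k. \<xi> i \<omega> * indicator {p i<..p (Suc i)} t)"

definition simple_integral ::
    "(real \<Rightarrow> 'a \<Rightarrow> real) \<Rightarrow> nat \<Rightarrow> (nat \<Rightarrow> real) \<Rightarrow> (nat \<Rightarrow> 'a \<Rightarrow> real) \<Rightarrow> real \<Rightarrow> 'a \<Rightarrow> real" where
  "simple_integral B k p \<xi> t \<omega> =
     (\<Sum>i<k. \<xi> i \<omega> * (B (min (p (Suc i)) t) \<omega> - B (min (p i) t) \<omega>))"

text \<open>
  \<open>I\<close> is the Ito integral process of \<open>H\<close> against \<open>B\<close>: the continuous process that is, at every time,
  the limit in probability of the integrals of simple processes approximating \<open>H\<close> in square mean
  over bounded time intervals, in probability.  This is the definition for all integrands that are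
  almost surely locally square integrable in time; no moment condition is imposed.
\<close>

definition ito_integral ::
    "'a measure \<Rightarrow> (real \<Rightarrow> 'a measure) \<Rightarrow> (real \<Rightarrow> 'a \<Rightarrow> real) \<Rightarrow> (real \<Rightarrow> 'a \<Rightarrow> real)
      \<Rightarrow> (real \<Rightarrow> 'a \<Rightarrow> real) \<Rightarrow> bool" where
  "ito_integral M F B H I \<longleftrightarrow>
     adapted F H \<and>
     (AE \<omega> in M. \<forall>t\<ge>0. (\<integral>\<^sup>+s\<in>{0..t}. ennreal ((H s \<omega>)\<^sup>2) \<partial>lborel) < \<infinity>) \<and>
     adapted F I \<and> continuous_paths M I \<and>
     (\<exists>k p \<xi>. (\<forall>n. simple_data M F (k n) (p n) (\<xi> n)) \<and>
        (\<forall>t\<ge>0.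
           tendsto_zero_in_prob M (\<lambda>n \<omega>.
             \<integral>\<^sup>+s\<in>{0..t}. ennreal ((simple_process (k n) (p n) (\<xi> n) s \<omega> - H s \<omega>)\<^sup>2) \<partial>lborel) \<and>
           tendsto_zero_in_prob M (\<lambda>n \<omega>.
             ennreal \<bar>simple_integral B (k n) (p n) (\<xi> n) t \<omega> - I t \<omega>\<bar>)))"


section \<open>Stochastic differential equations\<close>

text \<open>\<open>dX = \<mu>(X) dt + \<sigma>(X) dB\<close>, in integrated form.\<close>

definition sde_solution ::
    "'a measure \<Rightarrow> (real \<Rightarrow> 'a measure) \<Rightarrow> (real \<Rightarrow> 'a \<Rightarrow> real) \<Rightarrow> (real \<Rightarrow> real) \<Rightarrow> (real \<Rightarrow> real)
      \<Rightarrow> (real \<Rightarrow> 'a \<Rightarrow> real) \<Rightarrow> bool" where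
  "sde_solution M F B \<mu> \<sigma> X \<longleftrightarrow>
     stochastic_basis M F \<and> brownian_motion M F B \<and> adapted F X \<and> continuous_paths M X \<and>
     (\<exists>I. ito_integral M F B (\<lambda>t \<omega>. \<sigma> (X t \<omega>)) I \<and>
       (AE \<omega> in M. \<forall>t\<ge>0.
          set_integrable lborel {0..t} (\<lambda>s. \<mu> (X s \<omega>)) \<and>
          X t \<omega> = X 0 \<omega> + (LINT s:{0..t}|lborel. \<mu> (X s \<omega>)) + I t \<omega>))"

abbreviation path_space :: "(real \<Rightarrow> real) measure" where
  "path_space \<equiv> PiM {0..} (\<lambda>_. borel)"

definition sample_path :: "(real \<Rightarrow> 'a \<Rightarrow> real) \<Rightarrow> 'a \<Rightarrow> real \<Rightarrow> real" where
  "sample_path X \<omega> = (\<lambda>t\<in>{0..}. X t \<omega>)"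

text \<open>
  Existence of a unique strong solution in the sense of Ikeda and Watanabe (Stochastic Differential
  Equations and Diffusion Processes, Chapter IV, Section 1): there is a measurable functional
  \<open>\<Phi>\<close> of the initial value and the driving Brownian path that solves the equation for every
  Brownian motion and every initial value known at time 0, and every solution has this form.
  Taking for \<open>F\<close> the completed filtration generated by the initial value and the Brownian motion
  shows that the solution is adapted to it.  The equation is considered on all probability spaces
  over the sample type \<open>'a\<close>, since one cannot quantify over types.
\<close>

definition has_unique_strong_solution ::
    "'a itself \<Rightarrow> (real \<Rightarrow> real) \<Rightarrow> (real \<Rightarrow> real) \<Rightarrow> bool" where
  "has_unique_strong_solution _ \<mu> \<sigma> \<longleftrightarrow>
     \<mu> \<in> borel_measurable borel \<and> \<sigma> \<in> borel_measurable borel \<and>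
     (\<exists>\<Phi> :: real \<Rightarrow> (real \<Rightarrow> real) \<Rightarrow> real \<Rightarrow> real.
        (\<lambda>(x, w). \<Phi> x w) \<in> measurable (borel \<Otimes>\<^sub>M path_space) path_space \<and>
        (\<forall>(M :: 'a measure) F B. stochastic_basis M F \<and> brownian_motion M F B \<longrightarrow>
           (\<forall>\<xi> \<in> borel_measurable (F 0).
              sde_solution M F B \<mu> \<sigma> (\<lambda>t \<omega>. \<Phi> (\<xi> \<omega>) (sample_path B \<omega>) t) \<and>
              (AE \<omega> in M. \<Phi> (\<xi> \<omega>) (sample_path B \<omega>) 0 = \<xi> \<omega>)) \<and>
           (\<forall>X. sde_solution M F B \<mu> \<sigma> X \<longrightarrow>
              (AE \<omega> in M. \<forall>t\<ge>0. X t \<omega> = \<Phi> (X 0 \<omega>) (sample_path B \<omega>) t))))"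


section \<open>Diffusions with stochastic resetting\<close>

text \<open>
  The driving randomness: \<open>W n\<close> drives the process between the \<open>n\<close>-th and the next resetting event
  (with its own clock started at 0), and \<open>T n\<close> is the length of this period.  The resetting events
  form a Poisson process of rate \<open>r\<close>, given by its independent exponential waiting times.  That each
  \<open>W n\<close> is a Brownian motion is part of \<open>sde_solution\<close> below.
\<close>

abbreviation noise_space :: "((nat \<Rightarrow> real \<Rightarrow> real) \<times> (nat \<Rightarrow> real)) measure" where
  "noise_space \<equiv> PiM UNIV (\<lambda>_. path_space) \<Otimes>\<^sub>M PiM UNIV (\<lambda>_. borel)"

definition noise ::
    "(nat \<Rightarrow> real \<Rightarrow> 'a \<Rightarrow> real) \<Rightarrow> (nat \<Rightarrow> 'a \<Rightarrow> real) \<Rightarrow> 'a \<Rightarrow> (nat \<Rightarrow> real \<Rightarrow> real) \<times> (nat \<Rightarrow> real)" where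
  "noise W T \<omega> = ((\<lambda>n. sample_path (W n) \<omega>), (\<lambda>n. T n \<omega>))"

definition resetting_noise ::
    "'a measure \<Rightarrow> real \<Rightarrow> (nat \<Rightarrow> real \<Rightarrow> 'a \<Rightarrow> real) \<Rightarrow> (nat \<Rightarrow> 'a \<Rightarrow> real) \<Rightarrow> bool" where
  "resetting_noise M r W T \<longleftrightarrow>
     prob_space.indep_vars M (\<lambda>_. path_space) (\<lambda>n. sample_path (W n)) UNIV \<and>
     prob_space.indep_vars M (\<lambda>_. borel) T UNIV \<and>
     (\<forall>n. distributed M lborel (T n) (\<lambda>x. ennreal (exponential_density r x))) \<and>
     indep_rv M (PiM UNIV (\<lambda>_. path_space)) (\<lambda>\<omega> n. sample_path (W n) \<omega>)
                (PiM UNIV (\<lambda>_. borel)) (\<lambda>\<omega> n. T n \<omega>)"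

text \<open>Time of the \<open>n\<close>-th resetting event, with the convention that the 0-th one is at time 0.\<close>

definition reset_time :: "(nat \<Rightarrow> 'a \<Rightarrow> real) \<Rightarrow> nat \<Rightarrow> 'a \<Rightarrow> real" where
  "reset_time T n \<omega> = (\<Sum>i<n. T i \<omega>)"

definition resetting_diffusion ::
    "'a measure \<Rightarrow> (real \<Rightarrow> real) \<Rightarrow> (real \<Rightarrow> real) \<Rightarrow> real \<Rightarrow> real
      \<Rightarrow> (nat \<Rightarrow> real \<Rightarrow> 'a \<Rightarrow> real) \<Rightarrow> (nat \<Rightarrow> 'a \<Rightarrow> real) \<Rightarrow> ('a \<Rightarrow> real) \<Rightarrow> (real \<Rightarrow> 'a \<Rightarrow> real) \<Rightarrow> bool" where
  "resetting_diffusion M \<mu> \<sigma> r x\<^sub>R W T \<eta> \<X> \<longleftrightarrow>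
     resetting_noise M r W T \<and> indep_rv M borel \<eta> noise_space (noise W T) \<and>
     (\<exists>X. (\<forall>n. \<exists>F. sde_solution M F (W n) \<mu> \<sigma> (X n)) \<and>
          (AE \<omega> in M. X 0 0 \<omega> = \<eta> \<omega>) \<and>
          (\<forall>n\<ge>1. AE \<omega> in M. X n 0 \<omega> = x\<^sub>R) \<and>
          (AE \<omega> in M. \<forall>n t. reset_time T n \<omega> \<le> t \<and> t < reset_time T (Suc n) \<omega> \<longrightarrow>
             \<X> t \<omega> = X n (t - reset_time T n \<omega>) \<omega>))"


section \<open>First exit from an interval\<close>

definition exit_time :: "real \<Rightarrow> (real \<Rightarrow> 'a \<Rightarrow> real) \<Rightarrow> 'a \<Rightarrow> ereal" where
  "exit_time b \<X> \<omega> = Inf (ereal ` {t. 0 \<le> t \<and> \<X> t \<omega> \<notin> {0<..<b}})"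

definition exits_at :: "real \<Rightarrow> (real \<Rightarrow> 'a \<Rightarrow> real) \<Rightarrow> real \<Rightarrow> 'a \<Rightarrow> bool" where
  "exits_at b \<X> y \<omega> \<longleftrightarrow>
     exit_time b \<X> \<omega> < \<infinity> \<and> \<X> (real_of_ereal (exit_time b \<X> \<omega>)) \<omega> = y"

definition left_exit_prob :: "'a measure \<Rightarrow> real \<Rightarrow> (real \<Rightarrow> 'a \<Rightarrow> real) \<Rightarrow> real" where
  "left_exit_prob M b \<X> = measure M {\<omega> \<in> space M. exits_at b \<X> 0 \<omega>}"

text \<open>Classical solutions: the boundary values are attained continuously.\<close>

definition solves_exit_bvp ::
    "(real \<Rightarrow> real) \<Rightarrow> (real \<Rightarrow> real) \<Rightarrow> real \<Rightarrow> real \<Rightarrow> real \<Rightarrow> (real \<Rightarrow> real) \<Rightarrow> bool" where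
  "solves_exit_bvp \<mu> \<sigma> r x\<^sub>R b f \<longleftrightarrow>
     continuous_on {0..b} f \<and> f 0 = 1 \<and> f b = 0 \<and>
     (\<exists>f' f''. \<forall>x\<in>{0<..<b}.
        (f has_real_derivative f' x) (at x) \<and> (f' has_real_derivative f'' x) (at x) \<and>
        1 / 2 * (\<sigma> x)\<^sup>2 * f'' x + \<mu> x * f' x + r * (f x\<^sub>R - f x) = 0)"

end

theory Submission
  imports Defs
begin

text \<open>
  Pathwise, the process with resetting is a fixed measurable functional of its initial position and
  of the driving noise: by the strong-solution property, each piece between two resetting events is
  \<open>\<Phi>\<close> of its starting point (the initial position for the first piece, \<open>x\<^sub>R\<close> for the others) and of its
  own Brownian path.  Whether the process leaves \<open>(0, b)\<close> at 0 is therefore an event \<open>E (\<eta>, noise)\<close>.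
  The initial position is independent of the noise, so the law of the pair is a product, and Fubini's
  theorem gives \<open>q = P (E (\<eta>, noise)) = \<integral> g x * P (E (x, noise)) dx\<close>.  For a fixed \<open>x\<close>,
  \<open>E (x, noise)\<close> is almost surely the event that the process started at \<open>x\<close> leaves at 0, so its
  probability is \<open>\<pi>\<^sub>0 x\<close>.

  Two points need work.  The noise space carries the product \<open>\<sigma>\<close>-algebra on paths, for which first
  exits are not measurable; \<open>exits_left\<close> describes \<open>E\<close> by the values of the pieces at rational times,
  which is correct for continuous pieces (\<open>exits_at_iff_exits_left\<close>).  The pieces cover the whole time
  axis only if the resetting times tend to infinity, which holds almost surely by
  \<open>reset_time_unbounded\<close>.
\<close>

section \<open>Exit to the left, described at rational times\<close>

text \<open>
  For continuous \<open>f\<close> this says \<open>f < c\<close> on \<open>[0, u]\<close>: by compactness the supremum is attained, hence some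
  gap remains, and a non-strict bound extends from the rationals to the reals.
\<close>

definition strictly_below :: "(real \<Rightarrow> real) \<Rightarrow> real \<Rightarrow> real \<Rightarrow> bool" where
  "strictly_below f u c \<longleftrightarrow>
     (\<exists>k::nat. \<forall>s\<in>{0::rat..}. of_rat s \<le> u \<longrightarrow> f (of_rat s) \<le> c - 1 / Suc k)"

lemma strictly_below_iff:
  assumes cont: "continuous_on {0..u} f" and u: "0 \<le> u"
  shows "strictly_below f u c \<longleftrightarrow> (\<forall>s\<in>{0..u}. f s < c)"
proof
  assume "strictly_below f u c"
  then obtain k :: nat where k: "\<And>s::rat. 0 \<le> s \<Longrightarrow> of_rat s \<le> u \<Longrightarrow> f (of_rat s) \<le> c - 1 / Suc k"
    unfolding strictly_below_def by auto
  have "{0..u} \<subseteq> closure ({0..u} \<inter> \<rat>)"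
  proof (cases "u = 0")
    case True
    then show ?thesis using closure_subset by force
  next
    case False
    have "{0<..<u} \<subseteq> closure ({0<..<u} \<inter> \<rat>)"
      using open_Int_closure_subset[of "{0<..<u}" \<rat>] by (simp add: Rats_closure_real)
    also have "\<dots> \<subseteq> closure ({0..u} \<inter> \<rat>)" by (intro closure_mono) auto
    finally have "closure {0<..<u} \<subseteq> closure ({0..u} \<inter> \<rat>)"
      by (simp add: closure_minimal)
    then show ?thesis using False u by simp
  qed
  moreover have "closure ({0..u} \<inter> \<rat>) \<subseteq> {0..u}" by (intro closure_minimal) auto
  ultimately have cl: "closure ({0..u} \<inter> \<rat>) = {0..u}" by auto
  show "\<forall>s\<in>{0..u}. f s < c"
  proof
    fix s assume s: "s \<in> {0..u}"
    have "f s \<le> c - 1 / Suc k"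
    proof (rule continuous_le_on_closure[of "{0..u} \<inter> \<rat>" f])
      fix t assume "t \<in> {0..u} \<inter> \<rat>"
      then obtain r where r: "t = of_rat r" "0 \<le> t" "t \<le> u" by (auto elim: Rats_cases)
      then show "f t \<le> c - 1 / Suc k" using k[of r] by simp
    qed (use cont s cl in auto)
    also have "\<dots> < c" by simp
    finally show "f s < c" .
  qed
next
  assume *: "\<forall>s\<in>{0..u}. f s < c"
  have "\<exists>m\<in>{0..u}. \<forall>s\<in>{0..u}. f s \<le> f m"
    using cont u by (intro continuous_attains_sup) auto
  then obtain m where m: "m \<in> {0..u}" "\<And>s. s \<in> {0..u} \<Longrightarrow> f s \<le> f m" by blast
  obtain k :: nat where k: "1 / Suc k < c - f m"
    using * m(1) reals_Archimedean[of "c - f m"] by (auto simp: inverse_eq_divide)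
  show "strictly_below f u c"
    unfolding strictly_below_def
  proof (intro exI[of _ k] ballI impI)
    fix s :: rat assume "s \<in> {0..}" "of_rat s \<le> u"
    then show "f (of_rat s) \<le> c - 1 / Suc k" using m(2)[of "of_rat s"] k by auto
  qed
qed

text \<open>
  The \<open>n\<close>-th piece is the one that leaves.  Its exit time is not located, as it is irrational in
  general: a continuous path that starts inside the interval leaves it at 0 if, at some time \<open>u\<close>, it
  has been non-positive and has not reached \<open>b\<close>.  By continuity these times \<open>u\<close> include rational ones.
\<close>

definition exits_left :: "real \<Rightarrow> (nat \<Rightarrow> real \<Rightarrow> real) \<Rightarrow> (nat \<Rightarrow> real) \<Rightarrow> bool" where
  "exits_left b p T \<longleftrightarrow>
     (\<exists>n. (\<forall>i<n. \<forall>u\<in>{0::rat..}. of_rat u < T i \<longrightarrow>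
              strictly_below (p i) (of_rat u) b \<and> strictly_below (\<lambda>t. - p i t) (of_rat u) 0) \<and>
          (\<exists>u\<in>{0::rat..}. of_rat u < T n \<and>
              strictly_below (p n) (of_rat u) b \<and> \<not> strictly_below (\<lambda>t. - p n t) (of_rat u) 0))"

lemma exits_left_cong:
  assumes "\<And>n t. 0 \<le> t \<Longrightarrow> p n t = p' n t"
  shows "exits_left b p T = exits_left b p' T"
  using assms unfolding exits_left_def strictly_below_def by simp

lemma pred_strictly_below:
  assumes "\<And>t. 0 \<le> t \<Longrightarrow> (\<lambda>z. f z t) \<in> borel_measurable N"
  shows "Measurable.pred N (\<lambda>z. strictly_below (f z) u c)"
  unfolding strictly_below_def
  using assms by (intro pred_intros_countable pred_intros_countable_bounded pred_intros_logic) auto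

lemma pred_exits_left:
  assumes p: "\<And>n t. 0 \<le> t \<Longrightarrow> (\<lambda>z. p z n t) \<in> borel_measurable N"
    and T[measurable]: "\<And>n. (\<lambda>z. T z n) \<in> borel_measurable N"
  shows "Measurable.pred N (\<lambda>z. exits_left b (p z) (T z))"
proof -
  have [measurable]: "Measurable.pred N (\<lambda>z. strictly_below (p z n) u c)"
    "Measurable.pred N (\<lambda>z. strictly_below (\<lambda>t. - p z n t) u c)" for n u c
    using p by (intro pred_strictly_below borel_measurable_uminus; simp)+
  show ?thesis unfolding exits_left_def by measurable
qed

text \<open>
  For continuous pieces the rational times stand for all times: staying inside up to every rational
  time of a lifetime covers that lifetime, and staying below \<open>b\<close> is an open condition on \<open>u\<close>.
\<close>

lemma exits_left_iff:
  assumes cont: "\<And>n. continuous_on {0..} (p n)"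
  shows "exits_left b p T \<longleftrightarrow>
    (\<exists>n. (\<forall>i<n. \<forall>s. 0 \<le> s \<and> s < T i \<longrightarrow> p i s \<in> {0<..<b}) \<and>
         (\<exists>u. 0 \<le> u \<and> u < T n \<and> (\<forall>s\<in>{0..u}. p n s < b) \<and> (\<exists>s\<in>{0..u}. p n s \<le> 0)))"
proof -
  have c: "continuous_on {0..u} (p n)" for n u
    using cont[of n] by (rule continuous_on_subset) auto
  have below: "strictly_below (p n) u b \<longleftrightarrow> (\<forall>s\<in>{0..u}. p n s < b)"
    and above: "strictly_below (\<lambda>t. - p n t) u 0 \<longleftrightarrow> (\<forall>s\<in>{0..u}. 0 < p n s)" if "0 \<le> u" for n u
    using strictly_below_iff[OF c that, of n b] 
      strictly_below_iff[OF continuous_on_minus[OF c] that, of n 0] by auto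
  have stay: "(\<forall>u\<in>{0::rat..}. of_rat u < T i \<longrightarrow>
        strictly_below (p i) (of_rat u) b \<and> strictly_below (\<lambda>t. - p i t) (of_rat u) 0)
      \<longleftrightarrow> (\<forall>s. 0 \<le> s \<and> s < T i \<longrightarrow> p i s \<in> {0<..<b})" (is "?l \<longleftrightarrow> ?r") for i
  proof
    assume l: ?l
    show ?r
    proof (intro allI impI)
      fix s assume s: "0 \<le> s \<and> s < T i"
      then obtain u where u: "s < of_rat u" "of_rat u < T i" using of_rat_dense by blast
      then have "0 \<le> (of_rat u :: real)" using s by linarith
      then have u0: "0 \<le> u" by simp
      show "p i s \<in> {0<..<b}"
        using l u0 u s below[of "of_rat u" i] above[of "of_rat u" i] by auto
    qed
  next
    assume ?r
    then show ?l by (auto simp: below above)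
  qed
  have exit: "(\<exists>u\<in>{0::rat..}. of_rat u < T n \<and>
        strictly_below (p n) (of_rat u) b \<and> \<not> strictly_below (\<lambda>t. - p n t) (of_rat u) 0)
      \<longleftrightarrow> (\<exists>u. 0 \<le> u \<and> u < T n \<and> (\<forall>s\<in>{0..u}. p n s < b) \<and> (\<exists>s\<in>{0..u}. p n s \<le> 0))"
      (is "?l \<longleftrightarrow> ?r") for n
  proof
    assume ?l
    then obtain u :: rat where u: "0 \<le> u" "of_rat u < T n"
      "strictly_below (p n) (of_rat u) b" "\<not> strictly_below (\<lambda>t. - p n t) (of_rat u) 0" by auto
    then have "(\<forall>s\<in>{0..of_rat u}. p n s < b) \<and> (\<exists>s\<in>{0..of_rat u}. p n s \<le> 0)"
      by (auto simp: below above not_less)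
    then show ?r using u by (intro exI[of _ "of_rat u"]) auto
  next
    assume ?r
    then obtain u s where u: "0 \<le> u" "u < T n" "\<And>s. s \<in> {0..u} \<Longrightarrow> p n s < b"
      and s: "s \<in> {0..u}" "p n s \<le> 0" by blast
    \<comment> \<open>by continuity the piece stays below \<open>b\<close> a little longer, until a rational time\<close>
    have "\<exists>d>0. \<forall>v\<in>{0..}. dist v u < d \<longrightarrow> dist (p n v) (p n u) < b - p n u"
      using cont[of n] u(1) u(3)[of u] unfolding continuous_on_iff by auto
    then obtain d where d: "0 < d" "\<And>v. 0 \<le> v \<Longrightarrow> dist v u < d \<Longrightarrow> dist (p n v) (p n u) < b - p n u"
      by auto
    obtain v where v: "u < of_rat v" "of_rat v < min (u + d) (T n)"
      using of_rat_dense[of u "min (u + d) (T n)"] u d by auto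
    have "0 \<le> (of_rat v :: real)" using v u by linarith
    then have v0: "0 \<le> v" by simp
    have "p n t < b" if "t \<in> {0..of_rat v}" for t
    proof (cases "t \<le> u")
      case True
      then show ?thesis using u that by auto
    next
      case False
      then show ?thesis using d(2)[of t] that v u(1) by (auto simp: dist_real_def)
    qed
    moreover have "s \<in> {0..of_rat v}" using s v by auto
    ultimately have "strictly_below (p n) (of_rat v) b" "\<not> strictly_below (\<lambda>t. - p n t) (of_rat v) 0"
      using s v0 by (auto simp: below above not_less)
    then show ?l using v v0 by (intro bexI[of _ v]) auto
  qed
  show ?thesis unfolding exits_left_def stay exit ..
qed

text \<open>
  A time in a lifetime at which the piece is \<open>\<le> 0\<close> yields a first one, where the value is 0 by the
  intermediate value theorem; it is the first exit of the whole process.  Conversely the exit time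
  falls into the lifetime of one of the pieces, since these cover the time axis.
\<close>

lemma exits_at_iff_exits_left:
  assumes cont: "\<And>n. continuous_on {0..} (p n)"
    and start: "\<And>n. p n 0 \<in> {0<..<b}"
    and nonneg: "\<And>n. 0 \<le> T n \<omega>"
    and unbounded: "\<And>K. \<exists>n. K < reset_time T n \<omega>"
    and pieces: "\<And>n t. reset_time T n \<omega> \<le> t \<Longrightarrow> t < reset_time T (Suc n) \<omega> \<Longrightarrow>
                    \<X> t \<omega> = p n (t - reset_time T n \<omega>)"
  shows "exits_at b \<X> 0 \<omega> \<longleftrightarrow> exits_left b p (\<lambda>n. T n \<omega>)"
proof -
  define S where "S n = reset_time T n \<omega>" for n
  have Suc: "S (Suc n) = S n + T n \<omega>" for n by (simp add: S_def reset_time_def)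
  have S0: "S 0 = 0" by (simp add: S_def reset_time_def)
  have mono: "S m \<le> S n" if "m \<le> n" for m n
    using that by (rule lift_Suc_mono_le[rotated]) (simp add: Suc nonneg)
  have Snn: "0 \<le> S n" for n using mono[of 0 n] S0 by simp
  have piece: "\<exists>n. S n \<le> t \<and> t < S (Suc n)" if "0 \<le> t" for t
  proof -
    define m where "m = (LEAST m. t < S m)"
    have m: "t < S m" using unbounded[of t] unfolding m_def S_def by (rule LeastI_ex)
    have "m \<noteq> 0" using m S0 \<open>0 \<le> t\<close> by (intro notI) simp
    then obtain n where n: "m = Suc n" by (cases m) auto
    have "\<not> t < S n" unfolding m_def using not_less_Least[of n "\<lambda>m. t < S m"] n m_def by simp
    then show ?thesis using m n by (auto intro!: exI[of _ n])
  qed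
  have val: "\<X> t \<omega> = p n (t - S n)" if "S n \<le> t" "t < S (Suc n)" for n t
    using pieces[of n t] that by (simp add: S_def)
  define A where "A = {t. 0 \<le> t \<and> \<X> t \<omega> \<notin> {0<..<b}}"
  have ex: "exit_time b \<X> \<omega> = Inf (ereal ` A)" by (simp add: exit_time_def A_def)
  show ?thesis unfolding exits_left_iff[OF cont]
  proof
    assume e: "exits_at b \<X> 0 \<omega>"
    then have "A \<noteq> {}" unfolding exits_at_def ex by (auto simp: top_ereal_def)
    moreover have bdd: "bdd_below A" by (rule bdd_belowI[of _ 0]) (auto simp: A_def)
    ultimately have tau: "exit_time b \<X> \<omega> = ereal (Inf A)" and nn: "0 \<le> Inf A"
      unfolding ex by (auto simp: ereal_Inf' A_def intro!: cInf_greatest)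
    have zero: "\<X> (Inf A) \<omega> = 0" using e tau by (simp add: exits_at_def)
    have before: "\<X> t \<omega> \<in> {0<..<b}" if "0 \<le> t" "t < Inf A" for t
      using that cInf_lower[OF _ bdd, of t] by (force simp: A_def)
    obtain n where n: "S n \<le> Inf A" "Inf A < S (Suc n)" using piece[OF nn] by auto
    define u where "u = Inf A - S n"
    have pu: "p n u = 0" using val[OF n] zero by (simp add: u_def)
    have inside: "p n s \<in> {0<..<b}" if "0 \<le> s" "s < u" for s
      using before[of "S n + s"] val[of n "S n + s"] that n Snn[of n] by (simp add: u_def)
    have stay: "p i s \<in> {0<..<b}" if "i < n" "0 \<le> s" "s < T i \<omega>" for i s
      using before[of "S i + s"] val[of i "S i + s"] that n Snn[of i] Suc[of i] mono[of "Suc i" n]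
      by simp
    have "0 < b" using start[of 0] by auto
    then have "\<forall>s\<in>{0..u}. p n s < b"
      using inside pu by (metis atLeastAtMost_iff greaterThanLessThan_iff order_le_less)
    moreover have "0 \<le> u" "u < T n \<omega>" using n Suc by (auto simp: u_def)
    ultimately show "\<exists>n. (\<forall>i<n. \<forall>s. 0 \<le> s \<and> s < T i \<omega> \<longrightarrow> p i s \<in> {0<..<b}) \<and>
        (\<exists>u. 0 \<le> u \<and> u < T n \<omega> \<and> (\<forall>s\<in>{0..u}. p n s < b) \<and> (\<exists>s\<in>{0..u}. p n s \<le> 0))"
      using stay pu by (intro exI[of _ n] conjI exI[of _ u]) (auto intro!: bexI[of _ u])
  next
    assume "\<exists>n. (\<forall>i<n. \<forall>s. 0 \<le> s \<and> s < T i \<omega> \<longrightarrow> p i s \<in> {0<..<b}) \<and>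
        (\<exists>u. 0 \<le> u \<and> u < T n \<omega> \<and> (\<forall>s\<in>{0..u}. p n s < b) \<and> (\<exists>s\<in>{0..u}. p n s \<le> 0))"
    then obtain n u s where stay: "\<And>i s. i < n \<Longrightarrow> 0 \<le> s \<Longrightarrow> s < T i \<omega> \<Longrightarrow> p i s \<in> {0<..<b}"
      and u: "0 \<le> u" "u < T n \<omega>" "\<And>s. s \<in> {0..u} \<Longrightarrow> p n s < b" and s: "s \<in> {0..u}" "p n s \<le> 0"
      by blast
    have c: "continuous_on {0..s} (p n)" using cont[of n] by (rule continuous_on_subset) auto
    \<comment> \<open>the first zero of the \<open>n\<close>-th piece will be its exit time\<close>
    define Z where "Z = {0..s} \<inter> p n -` {0}"
    have "compact Z"
      unfolding Z_def compact_eq_bounded_closed using c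
      by (intro conjI continuous_closed_preimage) (auto intro: bounded_subset[OF bounded_closed_interval])
    moreover have "\<exists>x\<ge>0. x \<le> s \<and> p n x = 0"
      using IVT2'[of "p n" s 0 0] s start[of n] c by auto
    then have "Z \<noteq> {}" by (auto simp: Z_def)
    ultimately obtain z where z: "z \<in> Z" "\<And>y. y \<in> Z \<Longrightarrow> z \<le> y"
      using compact_attains_inf by metis
    have z': "0 \<le> z" "z \<le> u" "z \<le> s" "p n z = 0" using z s by (auto simp: Z_def)
    have pos: "0 < p n y" if y: "0 \<le> y" "y < z" for y
    proof (rule ccontr)
      assume "\<not> 0 < p n y"
      moreover have "continuous_on {0..y} (p n)" using cont[of n] by (rule continuous_on_subset) auto
      ultimately obtain x where "0 \<le> x" "x \<le> y" "p n x = 0"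
        using IVT2'[of "p n" y 0 0] y start[of n] by auto
      then show False using z(2)[of x] y z' by (auto simp: Z_def)
    qed
    have at: "\<X> (S n + z) \<omega> = 0" using val[of n "S n + z"] z' u Suc[of n] by simp
    have least: "S n + z \<le> t" if t: "t \<in> A" for t
    proof (rule ccontr)
      assume lt: "\<not> S n + z \<le> t"
      obtain i where i: "S i \<le> t" "t < S (Suc i)" using piece t by (auto simp: A_def)
      have "i \<le> n"
        using lt i z' u Suc[of n] mono[of "Suc n" i] by (cases "Suc n \<le> i") auto
      then consider "i < n" | "i = n" by linarith
      then have "p i (t - S i) \<in> {0<..<b}"
      proof cases
        case 1
        then show ?thesis using stay[of i "t - S i"] i Suc[of i] by simp
      next
        case 2
        then show ?thesis using pos[of "t - S n"] u(3)[of "t - S n"] i lt z' by simp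
      qed
      then show False using val[OF i] t by (simp add: A_def)
    qed
    have "S n + z \<in> A" using at z' Snn[of n] by (simp add: A_def)
    then have "Inf (ereal ` A) = ereal (S n + z)"
      using least by (intro Inf_eqI) auto
    then show "exits_at b \<X> 0 \<omega>" using at by (simp add: exits_at_def ex)
  qed
qed

section \<open>Resetting times\<close>

text \<open>
  The Laplace transform of the \<open>n\<close>-th resetting time is the \<open>n\<close>-th power of \<open>r / (r + 1) < 1\<close>, so
  \<open>exp (- reset_time T n)\<close> has infimum 0 almost surely.
\<close>

lemma (in prob_space) reset_time_unbounded:
  assumes r: "0 < r"
    and D: "\<And>n. distributed M lborel (T n) (\<lambda>x. ennreal (exponential_density r x))"
    and indep: "indep_vars (\<lambda>_. borel) T UNIV"
  shows "AE \<omega> in M. \<forall>K. \<exists>n. K < reset_time T n \<omega>"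
proof -
  define E where "E i \<omega> = ennreal (exp (- T i \<omega>))" for i \<omega>
  have [measurable]: "T i \<in> borel_measurable M" for i
    using distributed_measurable[OF D] by simp
  have EM[measurable]: "E i \<in> borel_measurable M" for i unfolding E_def by measurable
  have c: "(\<integral>\<^sup>+\<omega>. E i \<omega> \<partial>M) = ennreal (r / (r + 1))" for i
  proof -
    have "(\<integral>\<^sup>+\<omega>. E i \<omega> \<partial>M) = (\<integral>\<^sup>+x. ennreal (exponential_density r x) * ennreal (exp (- x)) \<partial>lborel)"
      unfolding E_def using distributed_nn_integral[OF D[of i], of "\<lambda>x. ennreal (exp (- x))"] by simp
    also have "\<dots> = (\<integral>\<^sup>+x. ennreal (r / (r + 1)) * ennreal (exponential_density (r + 1) x) \<partial>lborel)"
    proof (intro nn_integral_cong)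
      fix x :: real
      have "exponential_density r x * exp (- x) = r / (r + 1) * exponential_density (r + 1) x"
        using r by (simp add: exponential_density_def mult_exp_exp distrib_left add.commute)
      then show "ennreal (exponential_density r x) * ennreal (exp (- x)) =
          ennreal (r / (r + 1)) * ennreal (exponential_density (r + 1) x)"
        using r by (simp flip: ennreal_mult')
    qed
    also have "\<dots> = ennreal (r / (r + 1)) * (\<integral>\<^sup>+x. ennreal (exponential_density (r + 1) x) \<partial>lborel)"
      by (intro nn_integral_cmult) simp
    also have "(\<integral>\<^sup>+x. ennreal (exponential_density (r + 1) x) \<partial>lborel) = 1"
      using prob_space.emeasure_space_1[OF prob_space_exponential_density[of "r + 1"]] r
      by (simp add: emeasure_density)
    finally show ?thesis by simp
  qed
  have indepE: "indep_vars (\<lambda>_. borel) E UNIV"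
    using indep_vars_compose2[OF indep, of "\<lambda>_ x. ennreal (exp (- x))" "\<lambda>_. borel"]
    by (simp add: E_def[abs_def])
  have power: "(\<integral>\<^sup>+\<omega>. (\<Prod>i<n. E i \<omega>) \<partial>M) = ennreal ((r / (r + 1)) ^ n)" for n
    using indep_vars_nn_integral[of "{..<n}" E] indep_vars_subset[OF indepE] r
    by (simp add: c ennreal_power)
  have "(\<integral>\<^sup>+\<omega>. (INF n. \<Prod>i<n. E i \<omega>) \<partial>M) \<le> ennreal ((r / (r + 1)) ^ n)" for n
    unfolding power[symmetric] by (intro nn_integral_mono INF_lower) simp
  moreover have "(\<lambda>n. ennreal ((r / (r + 1)) ^ n)) \<longlonglongrightarrow> ennreal 0"
    using r by (intro tendsto_ennrealI LIMSEQ_power_zero) simp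
  ultimately have "(\<integral>\<^sup>+\<omega>. (INF n. \<Prod>i<n. E i \<omega>) \<partial>M) \<le> ennreal 0"
    by (intro LIMSEQ_le_const[of _ "ennreal 0"]) auto
  then have "(\<integral>\<^sup>+\<omega>. (INF n. \<Prod>i<n. E i \<omega>) \<partial>M) = 0" by simp
  then have "AE \<omega> in M. (INF n. \<Prod>i<n. E i \<omega>) = 0"
    by (subst (asm) nn_integral_0_iff_AE) auto
  then show ?thesis
  proof eventually_elim
    case (elim \<omega>)
    show ?case
    proof
      fix K
      have "(INF n. \<Prod>i<n. E i \<omega>) < ennreal (exp (- K))" using elim by simp
      then obtain n where "(\<Prod>i<n. E i \<omega>) < ennreal (exp (- K))" by (auto simp: INF_less_iff)
      then have "exp (- reset_time T n \<omega>) < exp (- K)"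
        by (simp add: E_def prod_ennreal exp_sum[symmetric] reset_time_def sum_negf ennreal_less_iff)
      then show "\<exists>n. K < reset_time T n \<omega>" by auto
    qed
  qed
qed

section \<open>Independence and completeness\<close>

lemma (in prob_space) distr_pair_indep_rv:
  assumes "indep_rv M N X K Y"
  shows "distr M (N \<Otimes>\<^sub>M K) (\<lambda>\<omega>. (X \<omega>, Y \<omega>)) = distr M N X \<Otimes>\<^sub>M distr M K Y"
proof -
  have [measurable]: "X \<in> measurable M N" "Y \<in> measurable M K"
    and indep: "indep_set {X -` A \<inter> space M | A. A \<in> sets N} {Y -` A \<inter> space M | A. A \<in> sets K}"
    using assms by (auto simp: indep_rv_def)
  interpret X: prob_space "distr M N X" by (rule prob_space_distr) simp
  interpret Y: prob_space "distr M K Y" by (rule prob_space_distr) simp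
  show ?thesis
  proof (rule pair_measure_eqI[symmetric])
    fix A B assume "A \<in> sets (distr M N X)" "B \<in> sets (distr M K Y)"
    then have [measurable]: "A \<in> sets N" "B \<in> sets K" by auto
    have "prob ((X -` A \<inter> space M) \<inter> (Y -` B \<inter> space M)) = prob (X -` A \<inter> space M) * prob (Y -` B \<inter> space M)"
      by (rule indep_setD[OF indep]) auto
    moreover have "(\<lambda>\<omega>. (X \<omega>, Y \<omega>)) -` (A \<times> B) \<inter> space M = (X -` A \<inter> space M) \<inter> (Y -` B \<inter> space M)"
      by auto
    ultimately show "emeasure (distr M N X) A * emeasure (distr M K Y) B =
        emeasure (distr M (N \<Otimes>\<^sub>M K) (\<lambda>\<omega>. (X \<omega>, Y \<omega>))) (A \<times> B)"
      by (simp add: emeasure_distr emeasure_eq_measure ennreal_mult)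
  qed (auto intro: X.sigma_finite_measure_axioms Y.sigma_finite_measure_axioms)
qed

text \<open>
  First-exit events are only almost surely equal to events visibly in the \<open>\<sigma>\<close>-algebra; completeness of
  the space makes them measurable, with the same probability.
\<close>

lemma (in complete_measure) measure_Collect_eq_AE:
  assumes ae: "AE \<omega> in M. P \<omega> \<longleftrightarrow> Q \<omega>" and Q: "{\<omega> \<in> space M. Q \<omega>} \<in> sets M"
  shows "measure M {\<omega> \<in> space M. P \<omega>} = measure M {\<omega> \<in> space M. Q \<omega>}"
proof (rule measure_eq_AE)
  show eq: "AE \<omega> in M. \<omega> \<in> {\<omega> \<in> space M. P \<omega>} \<longleftrightarrow> \<omega> \<in> {\<omega> \<in> space M. Q \<omega>}"
    using ae by eventually_elim auto
  then have "AE \<omega> in M. \<omega> \<in> {\<omega> \<in> space M. Q \<omega>} \<longleftrightarrow> \<omega> \<in> {\<omega> \<in> space M. P \<omega>}"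
    by eventually_elim auto
  then show "{\<omega> \<in> space M. P \<omega>} \<in> sets M" by (rule in_sets_AE) (use Q in auto)
qed (rule Q)

section \<open>The exit place as a functional of initial position and noise\<close>

definition exit_functional ::
    "(real \<Rightarrow> (real \<Rightarrow> real) \<Rightarrow> real \<Rightarrow> real) \<Rightarrow> real \<Rightarrow> real \<Rightarrow>
      real \<times> (nat \<Rightarrow> real \<Rightarrow> real) \<times> (nat \<Rightarrow> real) \<Rightarrow> bool" where
  "exit_functional \<Phi> x\<^sub>R b =
     (\<lambda>(x, w, T). exits_left b (\<lambda>n. \<Phi> (if n = 0 then x else x\<^sub>R) (w n)) T)"

lemma pred_exit_functional:
  assumes \<Phi>: "(\<lambda>(x, w). \<Phi> x w) \<in> measurable (borel \<Otimes>\<^sub>M path_space) path_space"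
  shows "Measurable.pred (borel \<Otimes>\<^sub>M noise_space) (exit_functional \<Phi> x\<^sub>R b)"
proof -
  have "Measurable.pred (borel \<Otimes>\<^sub>M noise_space)
     (\<lambda>z. exits_left b (\<lambda>n. \<Phi> (if n = 0 then fst z else x\<^sub>R) (fst (snd z) n)) (snd (snd z)))"
  proof (rule pred_exits_left)
    fix n and t :: real assume t: "0 \<le> t"
    have "(\<lambda>z. (if n = 0 then fst z else x\<^sub>R, fst (snd z) n))
       \<in> measurable (borel \<Otimes>\<^sub>M noise_space) (borel \<Otimes>\<^sub>M path_space)"
      by measurable
    from measurable_compose[OF measurable_compose[OF this \<Phi>] measurable_component_singleton[of t]]
    show "(\<lambda>z. \<Phi> (if n = 0 then fst z else x\<^sub>R) (fst (snd z) n) t)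
        \<in> borel_measurable (borel \<Otimes>\<^sub>M noise_space)"
      using t by simp
  qed measurable
  then show ?thesis by (simp add: exit_functional_def case_prod_unfold)
qed

text \<open>
  The exceptional null set depends on the initial position: the continuity of the pieces and their
  representation by \<open>\<Phi>\<close> hold almost surely for each initial position separately.  The statement
  therefore allows any \<open>\<eta>\<close>, so that it applies both to the random position and to each constant.
\<close>

lemma (in prob_space) AE_exits_at_iff_exit_functional:
  assumes r: "0 < r" and xR: "x\<^sub>R \<in> {0<..<b}"
    and \<Phi>: "\<And>F B X. sde_solution M F B \<mu> \<sigma> X \<Longrightarrow>
              AE \<omega> in M. \<forall>t\<ge>0. X t \<omega> = \<Phi> (X 0 \<omega>) (sample_path B \<omega>) t"
    and reset: "resetting_diffusion M \<mu> \<sigma> r x\<^sub>R W T \<eta> \<X>"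
    and initial: "AE \<omega> in M. \<eta> \<omega> \<in> {0<..<b}"
  shows "AE \<omega> in M. exits_at b \<X> 0 \<omega> \<longleftrightarrow> exit_functional \<Phi> x\<^sub>R b (\<eta> \<omega>, noise W T \<omega>)"
proof -
  from reset obtain X where
    X: "\<And>n. \<exists>F. sde_solution M F (W n) \<mu> \<sigma> (X n)"
    and X0: "AE \<omega> in M. X 0 0 \<omega> = \<eta> \<omega>" and Xn: "\<And>n. n \<ge> 1 \<Longrightarrow> AE \<omega> in M. X n 0 \<omega> = x\<^sub>R"
    and pieces: "AE \<omega> in M. \<forall>n t. reset_time T n \<omega> \<le> t \<and> t < reset_time T (Suc n) \<omega> \<longrightarrow>
             \<X> t \<omega> = X n (t - reset_time T n \<omega>) \<omega>"
    and noise: "resetting_noise M r W T"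
    unfolding resetting_diffusion_def by blast
  have D: "distributed M lborel (T n) (\<lambda>x. ennreal (exponential_density r x))" for n
    using noise by (auto simp: resetting_noise_def)
  have indep: "indep_vars (\<lambda>_. borel) T UNIV"
    using noise by (simp add: resetting_noise_def)
  have "AE \<omega> in M. 0 \<le> T n \<omega>" for n
    by (subst distributed_AE2[OF D]) (auto simp: exponential_density_def)
  then have nonneg: "AE \<omega> in M. \<forall>n. 0 \<le> T n \<omega>" by (simp add: AE_all_countable)
  have "AE \<omega> in M. continuous_on {0..} (\<lambda>t. X n t \<omega>)" for n
    using X[of n] by (auto simp: sde_solution_def continuous_paths_def)
  then have cont: "AE \<omega> in M. \<forall>n. continuous_on {0..} (\<lambda>t. X n t \<omega>)" by (simp add: AE_all_countable)
  have "AE \<omega> in M. X n 0 \<omega> = (if n = 0 then \<eta> \<omega> else x\<^sub>R)" for n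
    using X0 Xn[of n] by (cases "n = 0") auto
  then have start: "AE \<omega> in M. \<forall>n. X n 0 \<omega> = (if n = 0 then \<eta> \<omega> else x\<^sub>R)"
    by (simp add: AE_all_countable)
  have "AE \<omega> in M. \<forall>t\<ge>0. X n t \<omega> = \<Phi> (X n 0 \<omega>) (sample_path (W n) \<omega>) t" for n
    using X[of n] \<Phi> by auto
  then have repr: "AE \<omega> in M. \<forall>n. \<forall>t\<ge>0. X n t \<omega> = \<Phi> (X n 0 \<omega>) (sample_path (W n) \<omega>) t"
    by (simp add: AE_all_countable)
  show ?thesis
    using nonneg cont start repr pieces initial reset_time_unbounded[OF r D indep]
  proof eventually_elim
    case (elim \<omega>)
    have "exits_at b \<X> 0 \<omega> \<longleftrightarrow> exits_left b (\<lambda>n t. X n t \<omega>) (\<lambda>n. T n \<omega>)"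
      using elim(1-3,5-) xR by (intro exits_at_iff_exits_left) auto
    also have "\<dots> \<longleftrightarrow>
        exits_left b (\<lambda>n. \<Phi> (if n = 0 then \<eta> \<omega> else x\<^sub>R) (sample_path (W n) \<omega>)) (\<lambda>n. T n \<omega>)"
      using elim(3,4) by (intro exits_left_cong) metis
    finally show ?case by (simp add: exit_functional_def noise_def)
  qed
qed

theorem proposition2p1:
  fixes M :: "'a measure"
    and \<mu> \<sigma> :: "real \<Rightarrow> real"
    and b r x\<^sub>R q :: real
    and W :: "nat \<Rightarrow> real \<Rightarrow> 'a \<Rightarrow> real" and T :: "nat \<Rightarrow> 'a \<Rightarrow> real"
    and \<eta> :: "'a \<Rightarrow> real" and \<X> :: "real \<Rightarrow> 'a \<Rightarrow> real"
    and \<Y> :: "real \<Rightarrow> real \<Rightarrow> 'a \<Rightarrow> real"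
    and g \<pi>\<^sub>0 :: "real \<Rightarrow> real"
  assumes "prob_space M" and "complete_measure M"
    and "0 < b" and "0 < r" and "x\<^sub>R \<in> {0<..<b}" and "q \<in> {0<..<1}"
    and "has_unique_strong_solution TYPE('a) \<mu> \<sigma>"
    \<comment> \<open>the process with random initial position, and, for the same driving randomness,
        the process started at a point \<open>x\<close>\<close>
    and "resetting_diffusion M \<mu> \<sigma> r x\<^sub>R W T \<eta> \<X>"
    and "\<And>x. x \<in> {0<..<b} \<Longrightarrow> resetting_diffusion M \<mu> \<sigma> r x\<^sub>R W T (\<lambda>_. x) (\<Y> x)"
    \<comment> \<open>standing assumptions: the exit time is almost surely finite, exit is at 0 or at \<open>b\<close>,
        and the exit probability solves the boundary value problem\<close>
    and "\<And>x. x \<in> {0<..<b} \<Longrightarrow> AE \<omega> in M. exits_at b (\<Y> x) 0 \<omega> \<or> exits_at b (\<Y> x) b \<omega>"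
    and "\<And>x. x \<in> {0<..<b} \<Longrightarrow> \<pi>\<^sub>0 x = left_exit_prob M b (\<Y> x)"
    and "solves_exit_bvp \<mu> \<sigma> r x\<^sub>R b \<pi>\<^sub>0"
    \<comment> \<open>\<open>g\<close> is a density on \<open>(0, b)\<close> solving the inverse first-passage place problem\<close>
    and "\<And>x. x \<in> {0<..<b} \<Longrightarrow> 0 \<le> g x"
    and "distributed M lborel \<eta> (\<lambda>x. ennreal (g x) * indicator {0<..<b} x)"
    and "left_exit_prob M b \<X> = q"
  shows "q = (LINT x:{0<..<b}|lborel. g x * \<pi>\<^sub>0 x)"
proof -
  interpret prob_space M by fact
  interpret complete_measure M by fact
  note r = \<open>0 < r\<close> and xR = \<open>x\<^sub>R \<in> {0<..<b}\<close>
  have bm: "stochastic_basis M F \<and> brownian_motion M F B" if "sde_solution M F B \<mu> \<sigma> X" for F B X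
    using that by (simp add: sde_solution_def)
  obtain \<Phi> where \<Phi>: "(\<lambda>(x, w). \<Phi> x w) \<in> measurable (borel \<Otimes>\<^sub>M path_space) path_space"
    and \<Phi>_sol: "\<And>F B X. sde_solution M F B \<mu> \<sigma> X \<Longrightarrow>
              AE \<omega> in M. \<forall>t\<ge>0. X t \<omega> = \<Phi> (X 0 \<omega>) (sample_path B \<omega>) t"
    using \<open>has_unique_strong_solution TYPE('a) \<mu> \<sigma>\<close> bm
    unfolding has_unique_strong_solution_def by blast
  define E where "E = exit_functional \<Phi> x\<^sub>R b"
  have E[measurable]: "Measurable.pred (borel \<Otimes>\<^sub>M noise_space) E"
    unfolding E_def by (rule pred_exit_functional[OF \<Phi>])
  define N where "N = noise W T"
  define L where "L = distr M noise_space N"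
  have indep: "indep_rv M borel \<eta> noise_space N"
    using \<open>resetting_diffusion M \<mu> \<sigma> r x\<^sub>R W T \<eta> \<X>\<close> by (simp add: resetting_diffusion_def N_def)
  then have [measurable]: "N \<in> measurable M noise_space" "\<eta> \<in> borel_measurable M"
    by (auto simp: indep_rv_def)
  interpret L: prob_space L unfolding L_def by (rule prob_space_distr) simp
  have sets_L[measurable_cong]: "sets L = sets noise_space" by (simp add: L_def)
  have space_L: "space L = space noise_space" by (simp add: L_def)
  \<comment> \<open>the exit probability from \<open>x\<close>; unlike \<open>\<pi>\<^sub>0\<close>, which is given on the interval only, it is visibly
      Borel on the whole line\<close>
  define h where "h x = measure L {y \<in> space L. E (x, y)}" for x
  have h_meas[measurable]: "h \<in> borel_measurable borel" unfolding h_def by measurable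
  have ae: "AE \<omega> in M. exits_at b \<Z> 0 \<omega> \<longleftrightarrow> E (\<zeta> \<omega>, N \<omega>)"
    if "resetting_diffusion M \<mu> \<sigma> r x\<^sub>R W T \<zeta> \<Z>" "AE \<omega> in M. \<zeta> \<omega> \<in> {0<..<b}" for \<zeta> \<Z>
    unfolding E_def N_def by (rule AE_exits_at_iff_exit_functional[OF r xR \<Phi>_sol that])
  have D: "distributed M lborel \<eta> (\<lambda>x. ennreal (indicator {0<..<b} x * g x))"
  proof -
    have "(\<lambda>x. ennreal (g x) * indicator {0<..<b} x) = (\<lambda>x. ennreal (indicator {0<..<b} x * g x))"
      by (auto split: split_indicator)
    then show ?thesis using \<open>distributed M lborel \<eta> _\<close> by simp
  qed
  have "AE \<omega> in M. \<eta> \<omega> \<in> {0<..<b}"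
    by (subst distributed_AE2[OF D]) (auto split: split_indicator)
  then have "q = measure M {\<omega> \<in> space M. E (\<eta> \<omega>, N \<omega>)}"
    using measure_Collect_eq_AE[OF ae[OF \<open>resetting_diffusion M \<mu> \<sigma> r x\<^sub>R W T \<eta> \<X>\<close>]]
      \<open>left_exit_prob M b \<X> = q\<close> by (simp add: left_exit_prob_def)
  also have "ennreal \<dots> = emeasure (distr M (borel \<Otimes>\<^sub>M noise_space) (\<lambda>\<omega>. (\<eta> \<omega>, N \<omega>)))
      {z \<in> space (borel \<Otimes>\<^sub>M noise_space). E z}"
    by (subst emeasure_distr)
      (auto simp: emeasure_eq_measure[symmetric] dest: measurable_space[OF \<open>N \<in> _\<close>]
        intro!: arg_cong[where f="emeasure M"] simp: space_pair_measure)
  also have "\<dots> = emeasure (distr M borel \<eta> \<Otimes>\<^sub>M L) {z \<in> space (borel \<Otimes>\<^sub>M noise_space). E z}"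
    unfolding L_def distr_pair_indep_rv[OF indep] ..
  also have "\<dots> = (\<integral>\<^sup>+x. emeasure L (Pair x -` {z \<in> space (borel \<Otimes>\<^sub>M noise_space). E z}) \<partial>distr M borel \<eta>)"
    by (rule L.emeasure_pair_measure_alt) measurable
  also have "\<dots> = (\<integral>\<^sup>+x. ennreal (h x) \<partial>distr M borel \<eta>)"
    by (intro nn_integral_cong)
      (auto simp: h_def L.emeasure_eq_measure[symmetric] space_pair_measure space_L
        intro!: arg_cong[where f="emeasure L"])
  also have "\<dots> = (\<integral>\<^sup>+\<omega>. ennreal (h (\<eta> \<omega>)) \<partial>M)"
    by (simp add: nn_integral_distr)
  also have "\<dots> = ennreal (\<integral>\<omega>. h (\<eta> \<omega>) \<partial>M)"
    by (intro nn_integral_eq_integral integrable_const_bound[where B=1]) (auto simp: h_def)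
  finally have "q = (\<integral>\<omega>. h (\<eta> \<omega>) \<partial>M)"
    using \<open>q \<in> {0<..<1}\<close> by (simp add: h_def)
  also have "\<dots> = (\<integral>x. (indicator {0<..<b} x * g x) * h x \<partial>lborel)"
    using \<open>\<And>x. x \<in> {0<..<b} \<Longrightarrow> 0 \<le> g x\<close>
    by (intro distributed_integral[OF D, symmetric]) (auto split: split_indicator)
  also have "\<dots> = (\<integral>x. indicator {0<..<b} x * (g x * \<pi>\<^sub>0 x) \<partial>lborel)"
  proof (intro Bochner_Integration.integral_cong refl)
    fix x
    have "h x = \<pi>\<^sub>0 x" if x: "x \<in> {0<..<b}"
    proof -
      have "\<pi>\<^sub>0 x = measure M {\<omega> \<in> space M. E (x, N \<omega>)}"
        using measure_Collect_eq_AE[OF ae[OF assms(9)[OF x]]] assms(11)[OF x] x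
        by (simp add: left_exit_prob_def)
      also have "\<dots> = h x"
        unfolding h_def L_def
        by (subst measure_distr) (auto dest: measurable_space[OF \<open>N \<in> _\<close>] intro!: arg_cong[where f="measure M"])
      finally show ?thesis ..
    qed
    then show "indicator {0<..<b} x * g x * h x = indicator {0<..<b} x * (g x * \<pi>\<^sub>0 x)"
      by (auto split: split_indicator)
  qed
  finally show ?thesis by (simp add: set_lebesgue_integral_def)
qed

end
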